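(* Let $q_1 : \mathcal{P}_1 \twoheadrightarrow \mathcal{Q}_1$ and $q_2 : \mathcal{P}_2 \twoheadrightarrow \mathcal{Q}_2$ be quotients in $[\mathbf{Set},\mathbf{SupL}]$ with $\mathcal{P}_1$ and $\mathcal{P}_2$ projective objects of $[\mathbf{Set},\mathbf{SupL}]$. Then $q_1$ and $q_2$ are equivalent as consequence relations if and only if $\mathcal{Q}_1$ and $\mathcal{Q}_2$ are isomorphic in $[\mathbf{Set},\mathbf{SupL}]$.
   Context: A suplattice is a poset with arbitrary joins; $\mathbf{SupL}$ is the category of suplattices and maps preserving arbitrary joins. $[\mathbf{Set},\mathbf{SupL}]$ is the category of functors $\mathbf{Set}\to\mathbf{SupL}$ and natural transformations. A quotient is a natural transformation in $[\mathbf{Set},\mathbf{SupL}]$ all of whose components are surjective. An object $P$ of a category is projective if for every epimorphism $q : A \to B$ and every morphism $s : P \to B$ there is a morphism $t : P \to A$ with $q \circ t = s$. Each quotient $q : \mathcal{P}\twoheadrightarrow\mathcal{Q}$ induces a structural consequence relation on $\mathcal{P}$: for every set $X$ and $x,y \in \mathcal{P}X$, $x$ implies $y$ iff $q_X(y)\le q_X(x)$ in $\mathcal{Q}X$. Write $\vdash$ for the relation induced by $q_1$ and $\Vdash$ for that induced by $q_2$. A morphism from $q_1$ to $q_2$ is a pair $(\tau,\rho)$ of morphisms $\tau : \mathcal{P}_1\to\mathcal{P}_2$, $\rho : \mathcal{Q}_1\to\mathcal{Q}_2$ in $[\mathbf{Set},\mathbf{SupL}]$ with $\rho\circ q_1 =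 q_2\circ\tau$. It exhibits a (faithful) representation of $\vdash$ by $\Vdash$ if for every set $X$ and all $x,y\in\mathcal{P}_1X$: $x\vdash_X y \iff \tau_X(x)\Vdash_X\tau_X(y)$. The quotients $q_1,q_2$ are equivalent as consequence relations if there exist morphisms $\tau:\mathcal{P}_1\to\mathcal{P}_2$, $\delta:\mathcal{P}_2\to\mathcal{P}_1$ and an isomorphism $\rho:\mathcal{Q}_1\to\mathcal{Q}_2$ in $[\mathbf{Set},\mathbf{SupL}]$ such that $(\tau,\rho)$ is a morphism from $q_1$ to $q_2$ exhibiting a representation of $\vdash$ by $\Vdash$, and $(\delta,\rho^{-1})$ is a morphism from $q_2$ to $q_1$ exhibiting a representation of $\Vdash$ by $\vdash$. *)

theory Defs
  imports "HOL-Library.FuncSet" "HOL-Algebra.Lattice"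
begin

section \<open>Categories\<close>

text \<open>Hom-sets are not required to be disjoint, so composition takes the three objects involved:
  \<open>Comp C X Y Z g f\<close> is the composite of \<open>f : X \<rightarrow> Y\<close> followed by \<open>g : Y \<rightarrow> Z\<close>.\<close>

record ('o, 'm) cat =
  Obj :: "'o set"
  Hom :: "'o \<Rightarrow> 'o \<Rightarrow> 'm set"
  Ident :: "'o \<Rightarrow> 'm"
  Comp :: "'o \<Rightarrow> 'o \<Rightarrow> 'o \<Rightarrow> 'm \<Rightarrow> 'm \<Rightarrow> 'm"

locale category =
  fixes C :: "('o, 'm) cat"
  assumes Ident_in [intro]: "X \<in> Obj C \<Longrightarrow> Ident C X \<in> Hom C X X"
    and Comp_in [intro]: "\<lbrakk>X \<in> Obj C; Y \<in> Obj C; Z \<in> Obj C; f \<in> Hom C X Y; g \<in> Hom C Y Z\<rbrakk>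
          \<Longrightarrow> Comp C X Y Z g f \<in> Hom C X Z"
    and Comp_Ident_right: "\<lbrakk>X \<in> Obj C; Y \<in> Obj C; f \<in> Hom C X Y\<rbrakk>
          \<Longrightarrow> Comp C X X Y f (Ident C X) = f"
    and Comp_Ident_left: "\<lbrakk>X \<in> Obj C; Y \<in> Obj C; f \<in> Hom C X Y\<rbrakk>
          \<Longrightarrow> Comp C X Y Y (Ident C Y) f = f"
    and Comp_assoc: "\<lbrakk>W \<in> Obj C; X \<in> Obj C; Y \<in> Obj C; Z \<in> Obj C;
          f \<in> Hom C W X; g \<in> Hom C X Y; h \<in> Hom C Y Z\<rbrakk>
          \<Longrightarrow> Comp C W Y Z h (Comp C W X Y g f) = Comp C W X Z (Comp C X Y Z h g) f"

definition epimorphism :: "('o, 'm) cat \<Rightarrow> 'o \<Rightarrow> 'o \<Rightarrow> 'm \<Rightarrow> bool" where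
  "epimorphism C A B q \<longleftrightarrow> q \<in> Hom C A B \<and>
     (\<forall>Z\<in>Obj C. \<forall>g\<in>Hom C B Z. \<forall>h\<in>Hom C B Z. Comp C A B Z g q = Comp C A B Z h q \<longrightarrow> g = h)"

definition projective :: "('o, 'm) cat \<Rightarrow> 'o \<Rightarrow> bool" where
  "projective C P \<longleftrightarrow> P \<in> Obj C \<and>
     (\<forall>A\<in>Obj C. \<forall>B\<in>Obj C. \<forall>q s. epimorphism C A B q \<longrightarrow> s \<in> Hom C P B \<longrightarrow>
        (\<exists>t\<in>Hom C P A. Comp C P A B q t = s))"

definition inverse_arrows :: "('o, 'm) cat \<Rightarrow> 'o \<Rightarrow> 'o \<Rightarrow> 'm \<Rightarrow> 'm \<Rightarrow> bool" where
  "inverse_arrows C A B f g \<longleftrightarrow> f \<in> Hom C A B \<and> g \<in> Hom C B A \<and>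
     Comp C A B A g f = Ident C A \<and> Comp C B A B f g = Ident C B"

definition isomorphic :: "('o, 'm) cat \<Rightarrow> 'o \<Rightarrow> 'o \<Rightarrow> bool" where
  "isomorphic C A B \<longleftrightarrow> (\<exists>f g. inverse_arrows C A B f g)"

record ('o, 'm, 'p, 'n) functor_data =
  FObj :: "'o \<Rightarrow> 'p"
  FMor :: "'o \<Rightarrow> 'o \<Rightarrow> 'm \<Rightarrow> 'n"

definition is_functor ::
  "('o, 'm) cat \<Rightarrow> ('p, 'n) cat \<Rightarrow> ('o, 'm, 'p, 'n) functor_data \<Rightarrow> bool" where
  "is_functor C D F \<longleftrightarrow>
     (\<forall>X\<in>Obj C. FObj F X \<in> Obj D) \<and>
     (\<forall>X\<in>Obj C. \<forall>Y\<in>Obj C. \<forall>f\<in>Hom C X Y. FMor F X Y f \<in> Hom D (FObj F X) (FObj F Y)) \<and>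
     (\<forall>X\<in>Obj C. FMor F X X (Ident C X) = Ident D (FObj F X)) \<and>
     (\<forall>X\<in>Obj C. \<forall>Y\<in>Obj C. \<forall>Z\<in>Obj C. \<forall>f\<in>Hom C X Y. \<forall>g\<in>Hom C Y Z.
        FMor F X Z (Comp C X Y Z g f) =
        Comp D (FObj F X) (FObj F Y) (FObj F Z) (FMor F Y Z g) (FMor F X Y f))"

text \<open>Families of components are extensional, so that two natural transformations are equal as
  soon as their components at the objects of the source category agree.\<close>

definition nat_trans :: "('o, 'm) cat \<Rightarrow> ('p, 'n) cat \<Rightarrow>
    ('o, 'm, 'p, 'n) functor_data \<Rightarrow> ('o, 'm, 'p, 'n) functor_data \<Rightarrow> ('o \<Rightarrow> 'n) set" where
  "nat_trans C D F G =
     {\<eta> \<in> extensional (Obj C).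
        (\<forall>X\<in>Obj C. \<eta> X \<in> Hom D (FObj F X) (FObj G X)) \<and>
        (\<forall>X\<in>Obj C. \<forall>Y\<in>Obj C. \<forall>f\<in>Hom C X Y.
           Comp D (FObj F X) (FObj F Y) (FObj G Y) (\<eta> Y) (FMor F X Y f) =
           Comp D (FObj F X) (FObj G X) (FObj G Y) (FMor G X Y f) (\<eta> X))}"

definition functor_cat :: "('o, 'm) cat \<Rightarrow> ('p, 'n) cat \<Rightarrow>
    (('o, 'm, 'p, 'n) functor_data, 'o \<Rightarrow> 'n) cat" where
  "functor_cat C D =
     \<lparr>Obj = {F. is_functor C D F},
      Hom = nat_trans C D,
      Ident = (\<lambda>F. \<lambda>X\<in>Obj C. Ident D (FObj F X)),
      Comp = (\<lambda>F G H \<beta> \<alpha>. \<lambda>X\<in>Obj C. Comp D (FObj F X) (FObj G X) (FObj H X) (\<beta> X) (\<alpha> X))\<rparr>"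

lemma category_functor_cat:
  assumes "category C" "category D"
  shows "category (functor_cat C D)"
proof -
  interpret C: category C by fact
  interpret D: category D by fact
  show ?thesis
  proof
    fix F assume "F \<in> Obj (functor_cat C D)"
    then show "Ident (functor_cat C D) F \<in> Hom (functor_cat C D) F F"
      by (simp add: functor_cat_def nat_trans_def is_functor_def D.Ident_in
          D.Comp_Ident_left D.Comp_Ident_right)
  next
    fix F G H \<alpha> \<beta>
    assume "F \<in> Obj (functor_cat C D)" "G \<in> Obj (functor_cat C D)" "H \<in> Obj (functor_cat C D)"
      and "\<alpha> \<in> Hom (functor_cat C D) F G" "\<beta> \<in> Hom (functor_cat C D) G H"
    then have F: "is_functor C D F" and G: "is_functor C D G" and H: "is_functor C D H"
      and \<alpha>: "\<alpha> \<in> nat_trans C D F G" and \<beta>: "\<beta> \<in> nat_trans C D G H"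
      by (auto simp: functor_cat_def)
    have "Comp D (FObj F X) (FObj F Y) (FObj H Y)
            (Comp D (FObj F Y) (FObj G Y) (FObj H Y) (\<beta> Y) (\<alpha> Y)) (FMor F X Y f) =
          Comp D (FObj F X) (FObj H X) (FObj H Y) (FMor H X Y f)
            (Comp D (FObj F X) (FObj G X) (FObj H X) (\<beta> X) (\<alpha> X))"
      if X: "X \<in> Obj C" and Y: "Y \<in> Obj C" and f: "f \<in> Hom C X Y" for X Y f
    proof -
      have o: "FObj K X \<in> Obj D" "FObj K Y \<in> Obj D"
        "FMor K X Y f \<in> Hom D (FObj K X) (FObj K Y)" if "is_functor C D K" for K
        using that X Y f by (auto simp: is_functor_def)
      have a: "\<alpha> X \<in> Hom D (FObj F X) (FObj G X)" "\<alpha> Y \<in> Hom D (FObj F Y) (FObj G Y)"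
        "Comp D (FObj F X) (FObj F Y) (FObj G Y) (\<alpha> Y) (FMor F X Y f) =
         Comp D (FObj F X) (FObj G X) (FObj G Y) (FMor G X Y f) (\<alpha> X)"
        using \<alpha> X Y f by (auto simp: nat_trans_def)
      have b: "\<beta> X \<in> Hom D (FObj G X) (FObj H X)" "\<beta> Y \<in> Hom D (FObj G Y) (FObj H Y)"
        "Comp D (FObj G X) (FObj G Y) (FObj H Y) (\<beta> Y) (FMor G X Y f) =
         Comp D (FObj G X) (FObj H X) (FObj H Y) (FMor H X Y f) (\<beta> X)"
        using \<beta> X Y f by (auto simp: nat_trans_def)
      note o = o[OF F] o[OF G] o[OF H]
      have "Comp D (FObj F X) (FObj F Y) (FObj H Y)
              (Comp D (FObj F Y) (FObj G Y) (FObj H Y) (\<beta> Y) (\<alpha> Y)) (FMor F X Y f) =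
            Comp D (FObj F X) (FObj G Y) (FObj H Y) (\<beta> Y)
              (Comp D (FObj F X) (FObj F Y) (FObj G Y) (\<alpha> Y) (FMor F X Y f))"
        by (rule D.Comp_assoc[symmetric]) (use o a b in simp_all)
      also have "\<dots> = Comp D (FObj F X) (FObj G X) (FObj H Y)
              (Comp D (FObj G X) (FObj G Y) (FObj H Y) (\<beta> Y) (FMor G X Y f)) (\<alpha> X)"
        unfolding a(3) by (rule D.Comp_assoc) (use o a b in simp_all)
      also have "\<dots> = Comp D (FObj F X) (FObj H X) (FObj H Y) (FMor H X Y f)
              (Comp D (FObj F X) (FObj G X) (FObj H X) (\<beta> X) (\<alpha> X))"
        unfolding b(3) by (rule D.Comp_assoc[symmetric]) (use o a b in simp_all)
      finally show ?thesis .
    qed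
    moreover have "\<forall>X\<in>Obj C. Comp D (FObj F X) (FObj G X) (FObj H X) (\<beta> X) (\<alpha> X)
        \<in> Hom D (FObj F X) (FObj H X)"
      using F G H \<alpha> \<beta> by (auto simp: is_functor_def nat_trans_def)
    ultimately show "Comp (functor_cat C D) F G H \<beta> \<alpha> \<in> Hom (functor_cat C D) F H"
      by (auto simp: functor_cat_def nat_trans_def)
  next
    fix F G \<alpha>
    assume "F \<in> Obj (functor_cat C D)" "G \<in> Obj (functor_cat C D)"
      and "\<alpha> \<in> Hom (functor_cat C D) F G"
    then show "Comp (functor_cat C D) F F G \<alpha> (Ident (functor_cat C D) F) = \<alpha>"
      and "Comp (functor_cat C D) F G G (Ident (functor_cat C D) G) \<alpha> = \<alpha>"
      by (auto simp: functor_cat_def nat_trans_def is_functor_def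
          D.Comp_Ident_left D.Comp_Ident_right extensional_restrict cong: restrict_cong)
  next
    fix F G H K \<alpha> \<beta> \<gamma>
    assume "F \<in> Obj (functor_cat C D)" "G \<in> Obj (functor_cat C D)"
      and "H \<in> Obj (functor_cat C D)" "K \<in> Obj (functor_cat C D)"
      and "\<alpha> \<in> Hom (functor_cat C D) F G" "\<beta> \<in> Hom (functor_cat C D) G H"
      and "\<gamma> \<in> Hom (functor_cat C D) H K"
    then show "Comp (functor_cat C D) F H K \<gamma> (Comp (functor_cat C D) F G H \<beta> \<alpha>) =
        Comp (functor_cat C D) F G K (Comp (functor_cat C D) G H K \<gamma> \<beta>) \<alpha>"
      by (simp add: functor_cat_def nat_trans_def is_functor_def D.Comp_assoc cong: restrict_cong)
  qed
qed


section \<open>Sets and suplattices\<close>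

text \<open>HOL has no type of all sets. As usual when size matters, \<open>Set\<close> is the category of the sets
  belonging to a universe \<open>U\<close>; here these are sets of elements of a type \<open>'u\<close>. The closure
  conditions are those of a Grothendieck universe, except that power sets, not being sets of
  elements of \<open>'u\<close> themselves, are only required up to bijection. So \<open>U\<close> consists of the subsets
  of \<open>'u\<close> of cardinality less than some regular strong limit cardinal. No infinite member is
  demanded, which makes the notion satisfiable in HOL (see \<open>universe_finite_nat\<close>); universes
  with infinite members are included.\<close>

definition universe :: "'u set set \<Rightarrow> bool" where
  "universe U \<longleftrightarrow>
     U \<noteq> {} \<and>
     (\<forall>A\<in>U. \<forall>B. B \<subseteq> A \<longrightarrow> B \<in> U) \<and>
     (\<forall>A\<in>U. \<forall>f. f ` A \<in> U) \<and>
     (\<forall>I\<in>U. \<forall>F. (\<forall>i\<in>I. F i \<in> U) \<longrightarrow> (\<Union>i\<in>I. F i) \<in> U) \<and>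
     (\<forall>A\<in>U. \<exists>e. inj_on e (Pow A) \<and> e ` Pow A \<in> U)"

lemma universe_finite_nat: "universe {A :: nat set. finite A}"
proof -
  have "\<exists>e :: nat set \<Rightarrow> nat. inj_on e (Pow A)" if "finite A" for A
    using finite_imp_inj_to_nat_seg[of "Pow A"] that by auto
  then show ?thesis
    by (auto simp: universe_def intro: finite_subset)
qed

definition set_cat :: "'u set set \<Rightarrow> ('u set, 'u \<Rightarrow> 'u) cat" where
  "set_cat U =
     \<lparr>Obj = U,
      Hom = (\<lambda>X Y. X \<rightarrow>\<^sub>E Y),
      Ident = (\<lambda>X. \<lambda>x\<in>X. x),
      Comp = (\<lambda>X Y Z g f. compose X g f)\<rparr>"

lemma category_set_cat: "category (set_cat U)"
proof
  fix X Y f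
  assume "f \<in> Hom (set_cat U) X Y"
  then have "f \<in> X \<rightarrow> Y" "f \<in> extensional X"
    by (simp_all add: set_cat_def PiE_def)
  then show "Comp (set_cat U) X X Y f (Ident (set_cat U) X) = f"
    and "Comp (set_cat U) X Y Y (Ident (set_cat U) Y) f = f"
    by (simp_all add: set_cat_def Id_compose compose_Id)
next
  fix W X Y Z f g h
  assume "f \<in> Hom (set_cat U) W X"
  then have "f \<in> W \<rightarrow> X"
    by (simp add: set_cat_def PiE_def)
  then show "Comp (set_cat U) W Y Z h (Comp (set_cat U) W X Y g f) =
      Comp (set_cat U) W X Z (Comp (set_cat U) X Y Z h g) f"
    by (simp add: set_cat_def compose_assoc)
qed (auto simp: set_cat_def compose_def PiE_iff)

locale suplattice = partial_order L for L (structure) +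
  assumes sup_exists: "A \<subseteq> carrier L \<Longrightarrow> \<exists>s. least L s (Upper L A)"
begin

lemma sup_least:
  assumes "A \<subseteq> carrier L"
  shows "least L (\<Squnion>A) (Upper L A)"
  using sup_exists[OF assms] unfolding sup_def by (rule someI_ex)

lemma sup_closed: "A \<subseteq> carrier L \<Longrightarrow> \<Squnion>A \<in> carrier L"
  using sup_least by (rule least_closed) simp

end

definition supl_cat :: "'u set set \<Rightarrow> ('u gorder, 'u \<Rightarrow> 'u) cat" where
  "supl_cat U =
     \<lparr>Obj = {L. suplattice L \<and> carrier L \<in> U},
      Hom = (\<lambda>L M. {f \<in> carrier L \<rightarrow>\<^sub>E carrier M.
               \<forall>A. A \<subseteq> carrier L \<longrightarrow> f (\<Squnion>\<^bsub>L\<^esub> A) = \<Squnion>\<^bsub>M\<^esub> (f ` A)}),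
      Ident = (\<lambda>L. \<lambda>x\<in>carrier L. x),
      Comp = (\<lambda>L M N g f. compose (carrier L) g f)\<rparr>"

lemma category_supl_cat: "category (supl_cat U)"
proof
  fix L assume "L \<in> Obj (supl_cat U)"
  then interpret L: suplattice L by (simp add: supl_cat_def)
  have "(\<lambda>x\<in>carrier L. x) ` A = A" if "A \<subseteq> carrier L" for A
    using that by (simp add: subset_eq cong: image_cong)
  then show "Ident (supl_cat U) L \<in> Hom (supl_cat U) L L"
    by (simp add: supl_cat_def L.sup_closed)
next
  fix L M N f g
  assume "L \<in> Obj (supl_cat U)" "M \<in> Obj (supl_cat U)" "N \<in> Obj (supl_cat U)"
    and f: "f \<in> Hom (supl_cat U) L M" and g: "g \<in> Hom (supl_cat U) M N"
  then interpret L: suplattice L by (simp add: supl_cat_def)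
  have f': "f \<in> carrier L \<rightarrow> carrier M" "f ` A \<subseteq> carrier M"
    "f (\<Squnion>\<^bsub>L\<^esub> A) = \<Squnion>\<^bsub>M\<^esub> (f ` A)" if "A \<subseteq> carrier L" for A
    using f that by (auto simp: supl_cat_def PiE_def)
  have g': "g \<in> carrier M \<rightarrow> carrier N" "B \<subseteq> carrier M \<Longrightarrow> g (\<Squnion>\<^bsub>M\<^esub> B) = \<Squnion>\<^bsub>N\<^esub> (g ` B)" for B
    using g by (simp_all add: supl_cat_def PiE_def)
  have "compose (carrier L) g f (\<Squnion>\<^bsub>L\<^esub> A) = \<Squnion>\<^bsub>N\<^esub> (compose (carrier L) g f ` A)"
    if A: "A \<subseteq> carrier L" for A
  proof -
    have "compose (carrier L) g f ` A = (\<lambda>x. g (f x)) ` A"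
      by (rule image_cong) (use A in \<open>auto simp: compose_def\<close>)
    then have "compose (carrier L) g f ` A = g ` f ` A"
      by (simp only: image_image)
    then show ?thesis
      using A by (simp only: compose_eq L.sup_closed f'(3) g'(2)[OF f'(2)])
  qed
  then show "Comp (supl_cat U) L M N g f \<in> Hom (supl_cat U) L N"
    using funcset_compose[OF f'(1)[OF subset_refl] g'(1)]
    by (simp add: supl_cat_def PiE_def)
next
  fix L M f
  assume "f \<in> Hom (supl_cat U) L M"
  then have "f \<in> carrier L \<rightarrow> carrier M" "f \<in> extensional (carrier L)"
    by (simp_all add: supl_cat_def PiE_def)
  then show "Comp (supl_cat U) L L M f (Ident (supl_cat U) L) = f"
    and "Comp (supl_cat U) L M M (Ident (supl_cat U) M) f = f"
    by (simp_all add: supl_cat_def Id_compose compose_Id)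
next
  fix K L M N f g h
  assume "f \<in> Hom (supl_cat U) K L"
  then have "f \<in> carrier K \<rightarrow> carrier L"
    by (simp add: supl_cat_def PiE_def)
  then show "Comp (supl_cat U) K M N h (Comp (supl_cat U) K L M g f) =
      Comp (supl_cat U) K L N (Comp (supl_cat U) L M N h g) f"
    by (simp add: supl_cat_def compose_assoc)
qed


section \<open>Quotients and consequence relations\<close>

type_synonym 'u set_supl = "('u set, 'u \<Rightarrow> 'u, 'u gorder, 'u \<Rightarrow> 'u) functor_data"

abbreviation set_supl_cat :: "'u set set \<Rightarrow> ('u set_supl, 'u set \<Rightarrow> 'u \<Rightarrow> 'u) cat" where
  "set_supl_cat U \<equiv> functor_cat (set_cat U) (supl_cat U)"

definition is_quotient ::
  "'u set set \<Rightarrow> 'u set_supl \<Rightarrow> 'u set_supl \<Rightarrow> ('u set \<Rightarrow> 'u \<Rightarrow> 'u) \<Rightarrow> bool" where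
  "is_quotient U P Q q \<longleftrightarrow>
     P \<in> Obj (set_supl_cat U) \<and> Q \<in> Obj (set_supl_cat U) \<and> q \<in> Hom (set_supl_cat U) P Q \<and>
     (\<forall>X\<in>U. q X ` carrier (FObj P X) = carrier (FObj Q X))"

text \<open>\<open>entails Q q X x y\<close>: in the consequence relation induced by \<open>q : P \<rightarrow> Q\<close>, \<open>x\<close> implies \<open>y\<close>,
  for \<open>x\<close>, \<open>y\<close> in \<open>P X\<close>.\<close>

definition entails ::
  "'u set_supl \<Rightarrow> ('u set \<Rightarrow> 'u \<Rightarrow> 'u) \<Rightarrow> 'u set \<Rightarrow> 'u \<Rightarrow> 'u \<Rightarrow> bool" where
  "entails Q q X x y \<longleftrightarrow> q X y \<sqsubseteq>\<^bsub>FObj Q X\<^esub> q X x"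

definition quotient_morphism :: "'u set set \<Rightarrow>
    'u set_supl \<Rightarrow> 'u set_supl \<Rightarrow> ('u set \<Rightarrow> 'u \<Rightarrow> 'u) \<Rightarrow>
    'u set_supl \<Rightarrow> 'u set_supl \<Rightarrow> ('u set \<Rightarrow> 'u \<Rightarrow> 'u) \<Rightarrow>
    ('u set \<Rightarrow> 'u \<Rightarrow> 'u) \<Rightarrow> ('u set \<Rightarrow> 'u \<Rightarrow> 'u) \<Rightarrow> bool" where
  "quotient_morphism U P1 Q1 q1 P2 Q2 q2 \<tau> \<rho> \<longleftrightarrow>
     \<tau> \<in> Hom (set_supl_cat U) P1 P2 \<and> \<rho> \<in> Hom (set_supl_cat U) Q1 Q2 \<and>
     Comp (set_supl_cat U) P1 Q1 Q2 \<rho> q1 = Comp (set_supl_cat U) P1 P2 Q2 q2 \<tau>"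

definition exhibits_representation :: "'u set set \<Rightarrow>
    'u set_supl \<Rightarrow> 'u set_supl \<Rightarrow> ('u set \<Rightarrow> 'u \<Rightarrow> 'u) \<Rightarrow>
    'u set_supl \<Rightarrow> 'u set_supl \<Rightarrow> ('u set \<Rightarrow> 'u \<Rightarrow> 'u) \<Rightarrow>
    ('u set \<Rightarrow> 'u \<Rightarrow> 'u) \<Rightarrow> ('u set \<Rightarrow> 'u \<Rightarrow> 'u) \<Rightarrow> bool" where
  "exhibits_representation U P1 Q1 q1 P2 Q2 q2 \<tau> \<rho> \<longleftrightarrow>
     quotient_morphism U P1 Q1 q1 P2 Q2 q2 \<tau> \<rho> \<and>
     (\<forall>X\<in>U. \<forall>x\<in>carrier (FObj P1 X). \<forall>y\<in>carrier (FObj P1 X).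
        entails Q1 q1 X x y \<longleftrightarrow> entails Q2 q2 X (\<tau> X x) (\<tau> X y))"

definition equivalent_as_consequence_relations :: "'u set set \<Rightarrow>
    'u set_supl \<Rightarrow> 'u set_supl \<Rightarrow> ('u set \<Rightarrow> 'u \<Rightarrow> 'u) \<Rightarrow>
    'u set_supl \<Rightarrow> 'u set_supl \<Rightarrow> ('u set \<Rightarrow> 'u \<Rightarrow> 'u) \<Rightarrow> bool" where
  "equivalent_as_consequence_relations U P1 Q1 q1 P2 Q2 q2 \<longleftrightarrow>
     (\<exists>\<tau> \<delta> \<rho> \<rho>'. inverse_arrows (set_supl_cat U) Q1 Q2 \<rho> \<rho>' \<and>
        exhibits_representation U P1 Q1 q1 P2 Q2 q2 \<tau> \<rho> \<and>
        exhibits_representation U P2 Q2 q2 P1 Q1 q1 \<delta> \<rho>')"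

end

theory Submission
  imports Defs
begin

text \<open>Only the direction from an isomorphism \<open>\<rho> : Q1 \<rightarrow> Q2\<close> to an equivalence has content. A
  natural transformation with surjective components is an epimorphism
  (\<open>quotient_epimorphism\<close>), so projectivity of \<open>P1\<close> lifts \<open>\<rho> \<circ> q1\<close> along \<open>q2\<close> to a \<open>\<tau>\<close> with
  \<open>q2 \<circ> \<tau> = \<rho> \<circ> q1\<close> (\<open>projective_lifts_along_quotient\<close>), and projectivity of \<open>P2\<close> likewise lifts
  \<open>\<rho>\<inverse> \<circ> q2\<close> along \<open>q1\<close>. That the two representations are faithful is automatic: join-preserving
  maps are monotone, hence the components of an isomorphism both preserve and reflect the order, and
  \<open>q1 y \<le> q1 x\<close> holds exactly when \<open>\<rho> (q1 y) \<le> \<rho> (q1 x)\<close>, that is, when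
  \<open>q2 (\<tau> y) \<le> q2 (\<tau> x)\<close> (\<open>inverse_arrows_exhibits_representation\<close>).\<close>

lemma (in suplattice) sup_pair_eq:
  assumes "x \<in> carrier L" "y \<in> carrier L" "x \<sqsubseteq> y"
  shows "\<Squnion>{x, y} = y"
proof (rule least_unique)
  show "least L (\<Squnion>{x, y}) (Upper L {x, y})"
    using assms by (intro sup_least) simp
  show "least L y (Upper L {x, y})"
    using assms by (auto simp: least_def Upper_def)
qed

lemma supl_hom_mono:
  assumes "L \<in> Obj (supl_cat U)" "M \<in> Obj (supl_cat U)" "f \<in> Hom (supl_cat U) L M"
    and xy: "x \<in> carrier L" "y \<in> carrier L" "x \<sqsubseteq>\<^bsub>L\<^esub> y"
  shows "f x \<sqsubseteq>\<^bsub>M\<^esub> f y"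
proof -
  interpret L: suplattice L using assms by (simp add: supl_cat_def)
  interpret M: suplattice M using assms by (simp add: supl_cat_def)
  have f: "f x \<in> carrier M" "f y \<in> carrier M" "f (\<Squnion>\<^bsub>L\<^esub>{x, y}) = \<Squnion>\<^bsub>M\<^esub>(f ` {x, y})"
    using assms by (auto simp: supl_cat_def)
  have "\<Squnion>\<^bsub>M\<^esub>{f x, f y} \<in> Upper M {f x, f y}"
    using M.sup_least[of "{f x, f y}"] f by (simp add: least_def)
  moreover have "\<Squnion>\<^bsub>M\<^esub>{f x, f y} = f y"
    using f(3) by (simp add: L.sup_pair_eq[OF xy])
  ultimately show ?thesis
    using f by (simp add: Upper_def)
qed

lemma set_supl_objD:
  assumes "P \<in> Obj (set_supl_cat U)" "X \<in> U"
  shows "FObj P X \<in> Obj (supl_cat U)"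
  using assms by (simp add: functor_cat_def is_functor_def set_cat_def)

lemma set_supl_homD:
  assumes "\<alpha> \<in> Hom (set_supl_cat U) P Q" "X \<in> U"
  shows "\<alpha> X \<in> Hom (supl_cat U) (FObj P X) (FObj Q X)"
  using assms by (simp add: functor_cat_def nat_trans_def set_cat_def)

lemma set_supl_hom_closed:
  assumes "\<alpha> \<in> Hom (set_supl_cat U) P Q" "X \<in> U" "x \<in> carrier (FObj P X)"
  shows "\<alpha> X x \<in> carrier (FObj Q X)"
  using set_supl_homD[OF assms(1,2)] assms(3) by (auto simp: supl_cat_def)

lemma set_supl_hom_eqI:
  assumes \<alpha>: "\<alpha> \<in> Hom (set_supl_cat U) P Q" and \<beta>: "\<beta> \<in> Hom (set_supl_cat U) P Q"
    and eq: "\<And>X x. X \<in> U \<Longrightarrow> x \<in> carrier (FObj P X) \<Longrightarrow> \<alpha> X x = \<beta> X x"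
  shows "\<alpha> = \<beta>"
proof (rule extensionalityI[of _ U])
  show "\<alpha> \<in> extensional U" "\<beta> \<in> extensional U"
    using \<alpha> \<beta> by (simp_all add: functor_cat_def nat_trans_def set_cat_def)
  fix X assume X: "X \<in> U"
  show "\<alpha> X = \<beta> X"
    using set_supl_homD[OF \<alpha> X] set_supl_homD[OF \<beta> X] eq[OF X]
    by (auto simp: supl_cat_def PiE_iff intro: extensionalityI)
qed

lemma set_supl_Comp_apply:
  assumes "X \<in> U" "x \<in> carrier (FObj P X)"
  shows "Comp (set_supl_cat U) P Q R \<beta> \<alpha> X x = \<beta> X (\<alpha> X x)"
  using assms by (simp add: functor_cat_def set_cat_def supl_cat_def compose_eq)

lemma set_supl_Ident_apply:
  assumes "X \<in> U" "x \<in> carrier (FObj P X)"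
  shows "Ident (set_supl_cat U) P X x = x"
  using assms by (simp add: functor_cat_def set_cat_def supl_cat_def)

lemma inverse_arrows_sym: "inverse_arrows C A B f g \<Longrightarrow> inverse_arrows C B A g f"
  by (simp add: inverse_arrows_def)

lemma quotient_epimorphism:
  assumes "is_quotient U P Q q"
  shows "epimorphism (set_supl_cat U) P Q q"
  unfolding epimorphism_def
proof (intro conjI ballI impI)
  show "q \<in> Hom (set_supl_cat U) P Q"
    using assms by (simp add: is_quotient_def)
  fix Z \<alpha> \<beta>
  assume \<alpha>: "\<alpha> \<in> Hom (set_supl_cat U) Q Z" and \<beta>: "\<beta> \<in> Hom (set_supl_cat U) Q Z"
    and eq: "Comp (set_supl_cat U) P Q Z \<alpha> q = Comp (set_supl_cat U) P Q Z \<beta> q"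
  show "\<alpha> = \<beta>"
  proof (rule set_supl_hom_eqI[OF \<alpha> \<beta>])
    fix X y assume X: "X \<in> U" and "y \<in> carrier (FObj Q X)"
    then have "y \<in> q X ` carrier (FObj P X)"
      using assms by (simp add: is_quotient_def)
    then obtain x where x: "x \<in> carrier (FObj P X)" "y = q X x"
      by blast
    show "\<alpha> X y = \<beta> X y"
      using arg_cong[OF eq, of "\<lambda>\<gamma>. \<gamma> X x"] x
      by (simp add: set_supl_Comp_apply[OF X])
  qed
qed

lemma projective_lifts_along_quotient:
  assumes P1: "projective (set_supl_cat U) P1"
    and q1: "is_quotient U P1 Q1 q1" and q2: "is_quotient U P2 Q2 q2"
    and \<rho>: "\<rho> \<in> Hom (set_supl_cat U) Q1 Q2"
  obtains \<tau> where "quotient_morphism U P1 Q1 q1 P2 Q2 q2 \<tau> \<rho>"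
proof -
  interpret category "set_supl_cat U"
    by (intro category_functor_cat category_set_cat category_supl_cat)
  have "Comp (set_supl_cat U) P1 Q1 Q2 \<rho> q1 \<in> Hom (set_supl_cat U) P1 Q2"
    using q1 q2 \<rho> by (intro Comp_in) (simp_all add: is_quotient_def)
  then obtain \<tau> where "\<tau> \<in> Hom (set_supl_cat U) P1 P2"
    "Comp (set_supl_cat U) P1 P2 Q2 q2 \<tau> = Comp (set_supl_cat U) P1 Q1 Q2 \<rho> q1"
    using P1 q2 quotient_epimorphism[OF q2] unfolding projective_def is_quotient_def by meson
  with \<rho> have "quotient_morphism U P1 Q1 q1 P2 Q2 q2 \<tau> \<rho>"
    by (simp add: quotient_morphism_def)
  then show ?thesis
    by (rule that)
qed

text \<open>Monotonicity of \<open>\<rho>\<close> gives one implication and monotonicity of its inverse the other.\<close>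

lemma set_supl_iso_le_iff:
  assumes Q1: "Q1 \<in> Obj (set_supl_cat U)" and Q2: "Q2 \<in> Obj (set_supl_cat U)"
    and inv: "inverse_arrows (set_supl_cat U) Q1 Q2 \<rho> \<rho>'"
    and X: "X \<in> U" and a: "a \<in> carrier (FObj Q1 X)" and b: "b \<in> carrier (FObj Q1 X)"
  shows "\<rho> X a \<sqsubseteq>\<^bsub>FObj Q2 X\<^esub> \<rho> X b \<longleftrightarrow> a \<sqsubseteq>\<^bsub>FObj Q1 X\<^esub> b"
proof
  note obj = set_supl_objD[OF Q1 X] set_supl_objD[OF Q2 X]
  have \<rho>: "\<rho> \<in> Hom (set_supl_cat U) Q1 Q2" and \<rho>': "\<rho>' \<in> Hom (set_supl_cat U) Q2 Q1"
    and id: "Comp (set_supl_cat U) Q1 Q2 Q1 \<rho>' \<rho> = Ident (set_supl_cat U) Q1"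
    using inv by (simp_all add: inverse_arrows_def)
  have cancel: "\<rho>' X (\<rho> X c) = c" if "c \<in> carrier (FObj Q1 X)" for c
    using set_supl_Comp_apply[OF X that] set_supl_Ident_apply[OF X that] by (metis id)
  show "\<rho> X a \<sqsubseteq>\<^bsub>FObj Q2 X\<^esub> \<rho> X b" if "a \<sqsubseteq>\<^bsub>FObj Q1 X\<^esub> b"
    by (rule supl_hom_mono[OF obj set_supl_homD[OF \<rho> X] a b that])
  show "a \<sqsubseteq>\<^bsub>FObj Q1 X\<^esub> b" if "\<rho> X a \<sqsubseteq>\<^bsub>FObj Q2 X\<^esub> \<rho> X b"
    using supl_hom_mono[OF obj(2,1) set_supl_homD[OF \<rho>' X]
        set_supl_hom_closed[OF \<rho> X a] set_supl_hom_closed[OF \<rho> X b] that]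
    by (simp add: cancel a b)
qed

lemma inverse_arrows_exhibits_representation:
  assumes q1: "is_quotient U P1 Q1 q1" and Q2: "Q2 \<in> Obj (set_supl_cat U)"
    and inv: "inverse_arrows (set_supl_cat U) Q1 Q2 \<rho> \<rho>'"
    and mor: "quotient_morphism U P1 Q1 q1 P2 Q2 q2 \<tau> \<rho>"
  shows "exhibits_representation U P1 Q1 q1 P2 Q2 q2 \<tau> \<rho>"
  unfolding exhibits_representation_def
proof (intro conjI ballI mor)
  fix X x y
  assume X: "X \<in> U" and x: "x \<in> carrier (FObj P1 X)" and y: "y \<in> carrier (FObj P1 X)"
  have Q1: "Q1 \<in> Obj (set_supl_cat U)" and q1_hom: "q1 \<in> Hom (set_supl_cat U) P1 Q1"
    using q1 by (simp_all add: is_quotient_def)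
  have square: "q2 X (\<tau> X z) = \<rho> X (q1 X z)" if "z \<in> carrier (FObj P1 X)" for z
    using mor set_supl_Comp_apply[OF X that] unfolding quotient_morphism_def by metis
  show "entails Q1 q1 X x y \<longleftrightarrow> entails Q2 q2 X (\<tau> X x) (\<tau> X y)"
    unfolding entails_def square[OF x] square[OF y]
    by (rule set_supl_iso_le_iff[OF Q1 Q2 inv X, symmetric])
      (intro set_supl_hom_closed[OF q1_hom X] x y)+
qed

theorem corollary6p5:
  fixes U :: "'u set set"
    and P1 Q1 P2 Q2 :: "'u set_supl"
    and q1 q2 :: "'u set \<Rightarrow> 'u \<Rightarrow> 'u"
  assumes "universe U"
    and "is_quotient U P1 Q1 q1"
    and "is_quotient U P2 Q2 q2"
    and "projective (set_supl_cat U) P1"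
    and "projective (set_supl_cat U) P2"
  shows "equivalent_as_consequence_relations U P1 Q1 q1 P2 Q2 q2 \<longleftrightarrow>
         isomorphic (set_supl_cat U) Q1 Q2"
proof
  assume "equivalent_as_consequence_relations U P1 Q1 q1 P2 Q2 q2"
  then show "isomorphic (set_supl_cat U) Q1 Q2"
    unfolding equivalent_as_consequence_relations_def isomorphic_def by blast
next
  assume "isomorphic (set_supl_cat U) Q1 Q2"
  then obtain \<rho> \<rho>' where inv: "inverse_arrows (set_supl_cat U) Q1 Q2 \<rho> \<rho>'"
    unfolding isomorphic_def by blast
  then have hom: "\<rho> \<in> Hom (set_supl_cat U) Q1 Q2" "\<rho>' \<in> Hom (set_supl_cat U) Q2 Q1"
    by (simp_all add: inverse_arrows_def)
  have obj: "Q1 \<in> Obj (set_supl_cat U)" "Q2 \<in> Obj (set_supl_cat U)"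
    using assms(2,3) by (simp_all add: is_quotient_def)
  obtain \<tau> where \<tau>: "quotient_morphism U P1 Q1 q1 P2 Q2 q2 \<tau> \<rho>"
    using projective_lifts_along_quotient[OF assms(4,2,3) hom(1)] .
  obtain \<delta> where \<delta>: "quotient_morphism U P2 Q2 q2 P1 Q1 q1 \<delta> \<rho>'"
    using projective_lifts_along_quotient[OF assms(5,3,2) hom(2)] .
  show "equivalent_as_consequence_relations U P1 Q1 q1 P2 Q2 q2"
    unfolding equivalent_as_consequence_relations_def
    using inv inverse_arrows_exhibits_representation[OF assms(2) obj(2) inv \<tau>]
      inverse_arrows_exhibits_representation[OF assms(3) obj(1) inverse_arrows_sym[OF inv] \<delta>]
    by blast
qed

end
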